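(* Let $n\in\mathbb{N}$ and let $s=(s_\alpha)_{\alpha\in\mathbb{N}_0^n}\in\mathcal{S}_\infty$ be a determinate moment sequence. Then $\mathfrak{p}_s(t)$ is a determinate moment sequence for all $t\in\mathfrak{I}_s\cap(-\infty,0]$.
   Context: $\mathcal{S}_\infty$ is the set of all moment sequences, i.e. real sequences $s=(s_\alpha)_{\alpha\in\mathbb{N}_0^n}$ for which there is a positive Borel measure $\mu$ on $\mathbb{R}^n$ with all polynomials $\mu$-integrable such that $s_\alpha=\int_{\mathbb{R}^n}x^\alpha\,d\mu(x)$ for all $\alpha$; such $\mu$ is called a representing measure of $s$. A moment sequence is determinate if it has exactly one representing measure. For any real sequence $s=(s_\alpha)_{\alpha\in\mathbb{N}_0^n}$, $\mathfrak{p}_s(t)=(\mathfrak{p}_{s,\alpha}(t))_{\alpha\in\mathbb{N}_0^n}$, $t\in\mathbb{R}$, is the family of polynomials in $t$ uniquely determined recursively by $$\mathfrak{p}_{s,\alpha}(0)=s_\alpha,\qquad \frac{d}{dt}\mathfrak{p}_{s,\alpha}(t)=\sum_{j=1}^n\alpha_j(\alpha_j-1)\,\mathfrak{p}_{s,\alpha-2e_j}(t),$$ where $e_j$ is the $j$-th unit vector and terms with $\alpha_j\le 1$ are $0$ (evolution of moments under $\partial_tu=\Delta u$). For $s\in\mathcal{S}_\infty$ put $\mathfrak{I}_s:=\{t\in\mathbb{R}\mid\mathfrak{p}_s(t)\in\mathcal{S}_\infty\}$. *)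

theory Defs
  imports "HOL-Analysis.Analysis" "HOL-Computational_Algebra.Polynomial"
begin

(* Multi-indices in N_0^n are functions 'n => nat and R^n is real^'n, where n = CARD('n) >= 1. *)

definition mpow :: "real ^ 'n \<Rightarrow> ('n::finite \<Rightarrow> nat) \<Rightarrow> real" where
  "mpow x \<alpha> = (\<Prod>i\<in>UNIV. (x $ i) ^ \<alpha> i)"

(* Integrability is demanded separately from the moment equations, because the Bochner integral
   of a non-integrable function is 0. *)
definition representing_measure :: "(('n::finite \<Rightarrow> nat) \<Rightarrow> real) \<Rightarrow> (real ^ 'n) measure \<Rightarrow> bool" where
  "representing_measure s \<mu> \<longleftrightarrow>
     sets \<mu> = sets borel \<and>
     (\<forall>p. real_polynomial_function p \<longrightarrow> integrable \<mu> p) \<and>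
     (\<forall>\<alpha>. s \<alpha> = (LINT x|\<mu>. mpow x \<alpha>))"

definition moment_sequences :: "(('n::finite \<Rightarrow> nat) \<Rightarrow> real) set" where
  "moment_sequences = {s. \<exists>\<mu>. representing_measure s \<mu>}"

definition determinate :: "(('n::finite \<Rightarrow> nat) \<Rightarrow> real) \<Rightarrow> bool" where
  "determinate s \<longleftrightarrow> s \<in> moment_sequences \<and> (\<exists>!\<mu>. representing_measure s \<mu>)"

(* If \<alpha> j \<le> 1 then the coefficient \<alpha> j * (\<alpha> j - 1) is 0, so the truncated subtraction in
   \<alpha> - 2 e_j does no harm. *)
definition heat_moment_system ::
    "(('n::finite \<Rightarrow> nat) \<Rightarrow> real) \<Rightarrow> (('n \<Rightarrow> nat) \<Rightarrow> real poly) \<Rightarrow> bool" where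
  "heat_moment_system s p \<longleftrightarrow>
     (\<forall>\<alpha>. poly (p \<alpha>) 0 = s \<alpha> \<and>
          pderiv (p \<alpha>) =
            (\<Sum>j\<in>UNIV. of_nat (\<alpha> j * (\<alpha> j - 1)) * p (\<alpha>(j := \<alpha> j - 2))))"

definition heat_poly :: "(('n::finite \<Rightarrow> nat) \<Rightarrow> real) \<Rightarrow> ('n \<Rightarrow> nat) \<Rightarrow> real poly" where
  "heat_poly s = (THE p. heat_moment_system s p)"

definition heat_moments :: "(('n::finite \<Rightarrow> nat) \<Rightarrow> real) \<Rightarrow> real \<Rightarrow> ('n \<Rightarrow> nat) \<Rightarrow> real" where
  "heat_moments s t = (\<lambda>\<alpha>. poly (heat_poly s \<alpha>) t)"

definition moment_times :: "(('n::finite \<Rightarrow> nat) \<Rightarrow> real) \<Rightarrow> real set" where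
  "moment_times s = {t. heat_moments s t \<in> moment_sequences}"

lemma poly_antiderivative_ex:
  fixes q :: "real poly"
  shows "\<exists>p. pderiv p = q \<and> poly p 0 = c"
proof -
  define p where "p = pCons c (\<Sum>i\<le>degree q. monom (coeff q i / real (Suc i)) i)"
  have "coeff (pderiv p) k = coeff q k" for k
    by (auto simp: p_def coeff_pderiv coeff_sum if_distrib coeff_eq_0 field_simps
        simp del: of_nat_Suc)
  then have "pderiv p = q"
    by (simp add: poly_eq_iff)
  moreover have "poly p 0 = c"
    by (simp add: p_def)
  ultimately show ?thesis by blast
qed

lemma poly_antiderivative_unique:
  fixes p q :: "real poly"
  assumes "pderiv p = pderiv q" and "poly p 0 = poly q 0"
  shows "p = q"
proof -
  have "degree (p - q) = 0"
    using assms(1) by (simp add: pderiv_eq_0_iff[symmetric] pderiv_diff)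
  then obtain c where c: "p - q = [:c:]"
    by (metis degree_eq_zeroE)
  have "poly (p - q) 0 = 0"
    using assms(2) by simp
  then show ?thesis
    unfolding c using c by simp
qed

lemma sum_lower_two_less:
  fixes \<alpha> :: "'n::finite \<Rightarrow> nat"
  assumes "2 \<le> \<alpha> j"
  shows "(\<Sum>i\<in>UNIV. (\<alpha>(j := \<alpha> j - 2)) i) < (\<Sum>i\<in>UNIV. \<alpha> i)"
  by (rule sum_strict_mono_ex1) (use assms in \<open>auto intro!: exI[of _ j]\<close>)

function heat_poly_rec :: "(('n::finite \<Rightarrow> nat) \<Rightarrow> real) \<Rightarrow> ('n \<Rightarrow> nat) \<Rightarrow> real poly" where
  "heat_poly_rec s \<alpha> =
     (SOME p. pderiv p =
        (\<Sum>j\<in>UNIV. if 2 \<le> \<alpha> j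
           then of_nat (\<alpha> j * (\<alpha> j - 1)) * heat_poly_rec s (\<alpha>(j := \<alpha> j - 2)) else 0) \<and>
        poly p 0 = s \<alpha>)"
  by auto
termination
  by (relation "Wellfounded.measure (\<lambda>(s, \<alpha>). \<Sum>i\<in>UNIV. \<alpha> i)") (auto simp: sum_lower_two_less simp del: fun_upd_apply)

declare heat_poly_rec.simps [simp del]

lemma heat_moment_system_ex1:
  fixes s :: "('n::finite \<Rightarrow> nat) \<Rightarrow> real"
  shows "\<exists>!p. heat_moment_system s p"
proof (rule ex_ex1I)
  have "pderiv (heat_poly_rec s \<alpha>) =
        (\<Sum>j\<in>UNIV. of_nat (\<alpha> j * (\<alpha> j - 1)) * heat_poly_rec s (\<alpha>(j := \<alpha> j - 2))) \<and>
        poly (heat_poly_rec s \<alpha>) 0 = s \<alpha>" for \<alpha>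
  proof -
    have eq: "(\<Sum>j\<in>UNIV. if 2 \<le> \<alpha> j
           then of_nat (\<alpha> j * (\<alpha> j - 1)) * heat_poly_rec s (\<alpha>(j := \<alpha> j - 2)) else 0)
        = (\<Sum>j\<in>UNIV. of_nat (\<alpha> j * (\<alpha> j - 1)) * heat_poly_rec s (\<alpha>(j := \<alpha> j - 2)))"
      by (rule sum.cong) (auto simp: not_le less_2_cases_iff)
    show ?thesis
      unfolding heat_poly_rec.simps[of s \<alpha>] eq
      by (rule someI_ex) (rule poly_antiderivative_ex)
  qed
  then show "\<exists>p. heat_moment_system s p"
    by (auto simp: heat_moment_system_def)
next
  fix p q
  assume p: "heat_moment_system s p" and q: "heat_moment_system s q"
  have "p \<alpha> = q \<alpha>" for \<alpha>
  proof (induction "\<Sum>i\<in>UNIV. \<alpha> i" arbitrary: \<alpha> rule: less_induct)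
    case less
    have "of_nat (\<alpha> j * (\<alpha> j - 1)) * p (\<alpha>(j := \<alpha> j - 2)) =
          of_nat (\<alpha> j * (\<alpha> j - 1)) * q (\<alpha>(j := \<alpha> j - 2))" for j
    proof (cases "2 \<le> \<alpha> j")
      case True
      then show ?thesis using less[OF sum_lower_two_less] by metis
    next
      case False
      then show ?thesis by (auto simp: not_le less_2_cases_iff)
    qed
    then have "pderiv (p \<alpha>) = pderiv (q \<alpha>)"
      using p q unfolding heat_moment_system_def by presburger
    moreover have "poly (p \<alpha>) 0 = poly (q \<alpha>) 0"
      using p q unfolding heat_moment_system_def by presburger
    ultimately show ?case
      by (rule poly_antiderivative_unique)
  qed
  then show "p = q" by blast
qed

lemma heat_moment_system_heat_poly: "heat_moment_system s (heat_poly s)"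
  unfolding heat_poly_def by (rule theI'[OF heat_moment_system_ex1])

end

theory Submission
  imports Defs "HOL-Probability.Probability"
begin

text \<open>If \<open>\<nu>\<close> represents the moments at time \<open>t \<le> 0\<close>, let it flow forward for time \<open>- t\<close>, i.e. convolve it with
  the centred Gaussian of variance \<open>- 2 t\<close> in each coordinate. The moments of the result again solve the
  linear moment system, hence they equal \<open>s\<close>. By determinacy, any two such \<open>\<nu>\<close> have the same
  convolution with the Gaussian, and since the characteristic function of a Gaussian has no zeros,
  this forces them to coincide.\<close>

text \<open>The moment system is triangular and autonomous, so its solutions are polynomials in time
  and the comparison with \<open>s\<close> is purely formal: it holds for either sign of
  \<open>t\<close>. The sign enters only where \<open>- 2 * t\<close> has to be a variance; the
  factor 2 is there because the flow is generated by the full Laplacian and not by half of it.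
  Existence of a representing measure at time \<open>t\<close> is the hypothesis on
  \<open>t\<close>, so only uniqueness is at stake.

  Two obstacles shape the rest. Levy uniqueness concerns probability measures on the line, whereas
  representing measures live on R^n and have arbitrary finite mass, possibly 0. And for the smoothed
  measure to represent \<open>s\<close>, every polynomial must be integrable against it; the moment
  equations alone do not give this, so a domination argument has to come before Fubini.\<close>

section \<open>Caloric polynomials\<close>

text \<open>The caloric polynomials: the value of \<open>heat_monom k x\<close> at \<open>c\<close> is the mean of \<open>(x + Z) ^ k\<close> for a centred
  Gaussian \<open>Z\<close> of variance \<open>2 * c\<close>.\<close>

definition heat_monom :: "nat \<Rightarrow> real \<Rightarrow> real poly" where
  "heat_monom k x = (\<Sum>i\<le>k div 2. monom (fact k / (fact (k - 2 * i) * fact i) * x ^ (k - 2 * i)) i)"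

lemma coeff_heat_monom:
  "coeff (heat_monom k x) i =
     (if 2 * i \<le> k then fact k / (fact (k - 2 * i) * fact i) * x ^ (k - 2 * i) else 0)"
  by (auto simp: heat_monom_def coeff_sum if_distrib)

lemma degree_heat_monom: "degree (heat_monom k x) \<le> k"
  by (rule degree_le) (auto simp: coeff_heat_monom)

lemma poly_heat_monom_0 [simp]: "poly (heat_monom k x) 0 = x ^ k"
  by (simp add: poly_0_coeff_0 coeff_heat_monom)

lemma of_nat_mult_poly: "of_nat n * p = smult (of_nat n) (p :: real poly)"
  by (simp add: of_nat_poly)

lemma pderiv_heat_monom:
  "pderiv (heat_monom k x) = of_nat (k * (k - 1)) * heat_monom (k - 2) x"
proof (rule poly_eqI)
  fix i
  show "coeff (pderiv (heat_monom k x)) i = coeff (of_nat (k * (k - 1)) * heat_monom (k - 2) x) i"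
  proof (cases "2 * Suc i \<le> k")
    case True
    define m where "m = k - 2"
    have k: "k = Suc (Suc m)" and m: "2 * i \<le> m"
      using True by (auto simp: m_def)
    have fact: "fact (Suc (Suc m)) = real (Suc (Suc m)) * (real (Suc m) * fact m)"
        "fact (Suc i) = real (Suc i) * fact i"
      by (simp_all only: fact_Suc of_nat_Suc)
    \<comment> \<open>Used with a = i + 1: the factor produced by differentiating in time cancels
      the one split off from \<open>fact (Suc i)\<close>, while e = k is split off from
      \<open>fact k\<close>.\<close>
    have *: "a * (e * f / (g * (a * h)) * y) = e * (f / (g * h) * y)" if "a \<noteq> 0" for a e f g h y :: real
      using that by simp
    have "coeff (pderiv (heat_monom k x)) i = real (Suc i) * (real (Suc (Suc m)) * (real (Suc m) * fact m) /
        (fact (m - 2 * i) * (real (Suc i) * fact i)) * x ^ (m - 2 * i))"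
      using m unfolding k coeff_pderiv coeff_heat_monom fact by (simp del: fact_Suc of_nat_Suc)
    also have "\<dots> = real (Suc (Suc m)) * ((real (Suc m) * fact m) /
        (fact (m - 2 * i) * fact i) * x ^ (m - 2 * i))"
      by (rule *) simp
    also have "\<dots> = coeff (of_nat (k * (k - 1)) * heat_monom (k - 2) x) i"
      using m unfolding k of_nat_mult_poly coeff_smult coeff_heat_monom
      by (simp del: of_nat_Suc fact_Suc mult_Suc mult_Suc_right add: fact_Suc[of m])
    finally show ?thesis .
  next
    case False
    \<comment> \<open>For k <= 1 the truncated \<open>k - 2\<close> is wrong, but then the factor k
      (k - 1) vanishes.\<close>
    then have "k * (k - 1) = 0 \<or> \<not> 2 * i \<le> k - 2"
      by auto
    with False show ?thesis
      unfolding of_nat_mult_poly coeff_pderiv coeff_heat_monom coeff_smult by auto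
  qed
qed

text \<open>A product, because the Gaussian coordinates are independent; all factors share one time
  variable.\<close>

definition heat_mpow :: "('n::finite \<Rightarrow> nat) \<Rightarrow> real ^ 'n \<Rightarrow> real poly" where
  "heat_mpow \<alpha> x = (\<Prod>i\<in>UNIV. heat_monom (\<alpha> i) (x $ i))"

lemma poly_heat_mpow_0: "poly (heat_mpow \<alpha> x) 0 = mpow x \<alpha>"
  by (simp add: heat_mpow_def poly_prod mpow_def)

text \<open>The bound is uniform in \<open>x\<close>, so integrating over \<open>x\<close> involves
  a fixed finite set of coefficients.\<close>

lemma degree_heat_mpow: "degree (heat_mpow \<alpha> x) \<le> (\<Sum>i\<in>UNIV. \<alpha> i)"
  unfolding heat_mpow_def
  by (rule order.trans[OF degree_prod_sum_le]) (auto intro!: sum_mono degree_heat_monom)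

text \<open>The product rule in time yields one summand per coordinate, matching the sum of second
  derivatives in the Laplacian. Thus the recursion already holds pointwise in
  \<open>x\<close>.\<close>

lemma pderiv_heat_mpow:
  "pderiv (heat_mpow (\<alpha> :: 'n::finite \<Rightarrow> nat) x) =
     (\<Sum>j\<in>UNIV. of_nat (\<alpha> j * (\<alpha> j - 1)) * heat_mpow (\<alpha>(j := \<alpha> j - 2)) x)"
  unfolding heat_mpow_def pderiv_prod
proof (rule sum.cong[OF refl])
  fix j :: 'n
  have "(\<Prod>i\<in>UNIV. heat_monom ((\<alpha>(j := \<alpha> j - 2)) i) (x $ i)) =
      heat_monom (\<alpha> j - 2) (x $ j) * (\<Prod>i\<in>UNIV - {j}. heat_monom (\<alpha> i) (x $ i))"
    by (subst prod.remove[of _ j]) (auto intro!: prod.cong arg_cong2[where f = "(*)"])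
  then show "(\<Prod>i\<in>UNIV - {j}. heat_monom (\<alpha> i) (x $ i)) * pderiv (heat_monom (\<alpha> j) (x $ j)) =
      of_nat (\<alpha> j * (\<alpha> j - 1)) * (\<Prod>i\<in>UNIV. heat_monom ((\<alpha>(j := \<alpha> j - 2)) i) (x $ i))"
    unfolding pderiv_heat_monom by (simp only: mult_ac)
qed

lemma real_polynomial_function_component:
  "real_polynomial_function (\<lambda>x :: real ^ 'n. x $ i)"
  by (rule real_polynomial_function.intros(1)) (rule bounded_linear_vec_nth)

text \<open>Being polynomial in space is what makes each time coefficient integrable against a
  representing measure.\<close>

lemma real_polynomial_function_coeff_heat_mpow:
  "real_polynomial_function (\<lambda>x :: real ^ 'n::finite. coeff (heat_mpow \<alpha> x) k)"
proof -
  have "real_polynomial_function (\<lambda>x :: real ^ 'n. coeff (\<Prod>i\<in>S. heat_monom (\<alpha> i) (x $ i)) k)" for S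
  proof (induction S arbitrary: k rule: infinite_finite_induct)
    case (insert i S)
    have "real_polynomial_function (\<lambda>x :: real ^ 'n. coeff (heat_monom (\<alpha> i) (x $ i)) l)" for l
      unfolding coeff_heat_monom
      by (cases "2 * l \<le> \<alpha> i") (auto intro!: real_polynomial_function.intros(2,4)
        real_polynomial_function_power real_polynomial_function_component)
    with insert show ?case
      by (auto simp: coeff_mult intro!: real_polynomial_function_sum real_polynomial_function.intros(4))
  qed (auto simp: coeff_1 intro: real_polynomial_function.intros)
  then show ?thesis
    unfolding heat_mpow_def .
qed

lemma poly_altdef_degree_le:
  fixes p :: "real poly"
  assumes "degree p \<le> d"
  shows "poly p c = (\<Sum>k\<le>d. coeff p k * c ^ k)"
  unfolding poly_altdef by (rule sum.mono_neutral_left) (use assms in \<open>auto simp: coeff_eq_0\<close>)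

section \<open>Averaging caloric polynomials against a representing measure\<close>

context
  fixes m :: "('n::finite \<Rightarrow> nat) \<Rightarrow> real" and \<nu> :: "(real ^ 'n) measure"
  assumes \<nu>: "representing_measure m \<nu>"
begin

text \<open>Integration is done coefficientwise, so that the average is again an element of
  \<open>real poly\<close> and can be compared with \<open>heat_poly\<close>.\<close>

definition integrated_heat_mpow :: "('n \<Rightarrow> nat) \<Rightarrow> real poly" where
  "integrated_heat_mpow \<alpha> =
     (\<Sum>k\<le>(\<Sum>i\<in>UNIV. \<alpha> i). monom (LINT x|\<nu>. coeff (heat_mpow \<alpha> x) k) k)"

lemma integrable_coeff_heat_mpow: "integrable \<nu> (\<lambda>x. coeff (heat_mpow \<alpha> x) k)"
  using \<nu> real_polynomial_function_coeff_heat_mpow unfolding representing_measure_def by blast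

lemma coeff_integrated_heat_mpow:
  "coeff (integrated_heat_mpow \<alpha>) k = (LINT x|\<nu>. coeff (heat_mpow \<alpha> x) k)"
proof (cases "k \<le> (\<Sum>i\<in>UNIV. \<alpha> i)")
  case True
  then show ?thesis
    by (simp add: integrated_heat_mpow_def coeff_sum if_distrib)
next
  case False
  then have "coeff (heat_mpow \<alpha> x) k = 0" for x
    by (intro coeff_eq_0) (meson degree_heat_mpow linorder_not_less order.trans)
  then show ?thesis
    using False by (simp add: integrated_heat_mpow_def coeff_sum if_distrib)
qed

lemma poly_integrated_heat_mpow:
  "poly (integrated_heat_mpow \<alpha>) c = (LINT x|\<nu>. poly (heat_mpow \<alpha> x) c)"
proof -
  have "(LINT x|\<nu>. poly (heat_mpow \<alpha> x) c) =
      (LINT x|\<nu>. (\<Sum>k\<le>(\<Sum>i\<in>UNIV. \<alpha> i). coeff (heat_mpow \<alpha> x) k * c ^ k))"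
    by (simp add: poly_altdef_degree_le[OF degree_heat_mpow])
  also have "\<dots> = (\<Sum>k\<le>(\<Sum>i\<in>UNIV. \<alpha> i). (LINT x|\<nu>. coeff (heat_mpow \<alpha> x) k) * c ^ k)"
    by (subst Bochner_Integration.integral_sum) (auto intro: integrable_coeff_heat_mpow)
  also have "\<dots> = poly (integrated_heat_mpow \<alpha>) c"
    by (simp add: integrated_heat_mpow_def poly_sum poly_monom)
  finally show ?thesis ..
qed

text \<open>The system is linear and holds for every fixed \<open>x\<close>, so integration over
  \<open>x\<close> preserves it.\<close>

lemma heat_moment_system_integrated: "heat_moment_system m integrated_heat_mpow"
  unfolding heat_moment_system_def
proof (intro allI conjI)
  fix \<alpha>
  show "poly (integrated_heat_mpow \<alpha>) 0 = m \<alpha>"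
    using \<nu> by (simp add: poly_integrated_heat_mpow poly_heat_mpow_0 representing_measure_def)
  show "pderiv (integrated_heat_mpow \<alpha>) =
      (\<Sum>j\<in>UNIV. of_nat (\<alpha> j * (\<alpha> j - 1)) * integrated_heat_mpow (\<alpha>(j := \<alpha> j - 2)))"
  proof (rule poly_eqI)
    fix k
    have "coeff (pderiv (integrated_heat_mpow \<alpha>)) k = (LINT x|\<nu>. coeff (pderiv (heat_mpow \<alpha> x)) k)"
      by (simp add: coeff_pderiv coeff_integrated_heat_mpow)
    also have "\<dots> = (LINT x|\<nu>. (\<Sum>j\<in>UNIV.
        of_nat (\<alpha> j * (\<alpha> j - 1)) * coeff (heat_mpow (\<alpha>(j := \<alpha> j - 2)) x) k))"
      unfolding pderiv_heat_mpow of_nat_mult_poly coeff_sum coeff_smult ..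
    also have "\<dots> = (\<Sum>j\<in>UNIV. of_nat (\<alpha> j * (\<alpha> j - 1)) *
        (LINT x|\<nu>. coeff (heat_mpow (\<alpha>(j := \<alpha> j - 2)) x) k))"
      by (subst Bochner_Integration.integral_sum)
        (auto intro!: integrable_coeff_heat_mpow integrable_mult_right simp del: of_nat_mult)
    finally show "coeff (pderiv (integrated_heat_mpow \<alpha>)) k =
        coeff (\<Sum>j\<in>UNIV. of_nat (\<alpha> j * (\<alpha> j - 1)) * integrated_heat_mpow (\<alpha>(j := \<alpha> j - 2))) k"
      unfolding of_nat_mult_poly coeff_sum coeff_smult coeff_integrated_heat_mpow .
  qed
qed

end

text \<open>The coefficients of the system do not depend on time, so a solution may be restarted at
  any time.\<close>

lemma heat_moment_system_shift:
  assumes "heat_moment_system s p"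
  shows "heat_moment_system (\<lambda>\<alpha>. poly (p \<alpha>) t) (\<lambda>\<alpha>. pcompose (p \<alpha>) [:t, 1:])"
  using assms unfolding heat_moment_system_def
  by (simp add: poly_pcompose pderiv_pcompose pderiv_pCons pcompose_sum pcompose_smult of_nat_mult_poly
      del: of_nat_mult)

text \<open>The polynomials of \<open>s\<close> restarted at \<open>t\<close> and the caloric
  averages over \<open>\<nu>\<close> solve the system with the same initial values, hence coincide;
  evaluation at \<open>- t\<close> returns to time 0.\<close>

lemma backward_heat_moments:
  assumes "representing_measure (heat_moments s t) \<nu>"
  shows "s \<alpha> = (LINT x|\<nu>. poly (heat_mpow \<alpha> x) (- t))"
proof -
  have "heat_moment_system (heat_moments s t) (\<lambda>\<alpha>. pcompose (heat_poly s \<alpha>) [:t, 1:])"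
    unfolding heat_moments_def
    by (rule heat_moment_system_shift) (rule heat_moment_system_heat_poly)
  then have "integrated_heat_mpow \<nu> = (\<lambda>\<alpha>. pcompose (heat_poly s \<alpha>) [:t, 1:])"
    using heat_moment_system_integrated[OF assms] heat_moment_system_ex1 by blast
  then have "(LINT x|\<nu>. poly (heat_mpow \<alpha> x) (- t)) = poly (pcompose (heat_poly s \<alpha>) [:t, 1:]) (- t)"
    using poly_integrated_heat_mpow[OF assms] by metis
  also have "\<dots> = s \<alpha>"
    using heat_moment_system_heat_poly[of s] by (simp add: poly_pcompose heat_moment_system_def)
  finally show ?thesis ..
qed

section \<open>Deconvolution\<close>

lemma char_convolution:
  assumes "real_distribution M" "real_distribution N"
  shows "char (M \<star> N) t = char M t * char N t"
proof -
  interpret M: real_distribution M by fact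
  interpret N: real_distribution N by fact
  interpret pair_prob_space M N ..
  have int: "integrable (M \<Otimes>\<^sub>M N) (\<lambda>(x, y). iexp (t * (x + y)))"
    unfolding split_beta' by (rule integrable_const_bound[of _ 1]) auto
  have "char (M \<star> N) t = (CLINT z|M \<Otimes>\<^sub>M N. iexp (t * (fst z + snd z)))"
    unfolding char_def convolution_def by (subst integral_distr) (auto simp: split_beta')
  also have "\<dots> = (CLINT x|M. CLINT y|N. iexp (t * (x + y)))"
    using integral_fst'[OF int] by (simp add: split_beta')
  also have "\<dots> = (CLINT x|M. CLINT y|N. iexp (t * x) * iexp (t * y))"
    by (simp add: exp_add[symmetric] ring_distribs)
  also have "\<dots> = char M t * char N t"
    by (simp add: char_def)
  finally show ?thesis .
qed

lemma real_distribution_convolution_cancel: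
  assumes M1: "real_distribution M1" and M2: "real_distribution M2" and N: "real_distribution N"
    and char: "\<And>t. char N t \<noteq> 0"
    and eq: "(M1 \<star> N) = (M2 \<star> N)"
  shows "M1 = M2"
proof (rule Levy_uniqueness[OF M1 M2], rule ext)
  fix t
  have "char M1 t * char N t = char M2 t * char N t"
    unfolding char_convolution[OF M1 N, symmetric] char_convolution[OF M2 N, symmetric] eq ..
  then show "char M1 t = char M2 t"
    using char by simp
qed

lemma emeasure_convolution_real:
  assumes "finite_measure M" "finite_measure N"
    and "sets M = sets borel" "sets N = sets (borel :: real measure)" and "A \<in> sets borel"
  shows "emeasure (M \<star> N) A = (\<integral>\<^sup>+x. emeasure N {z. x + z \<in> A} \<partial>M)"
  using assms sets_eq_imp_space_eq[OF assms(3)] sets_eq_imp_space_eq[OF assms(4)]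
  by (subst convolution_emeasure) (auto simp: add.commute)

lemma borel_measurable_emeasure_translate:
  assumes "real_distribution N" and A [measurable]: "A \<in> sets borel"
  shows "(\<lambda>x. emeasure N {z. x + z \<in> A}) \<in> borel_measurable borel"
proof -
  interpret N: real_distribution N by fact
  have "{p \<in> space (borel \<Otimes>\<^sub>M N). fst p + snd p \<in> A} \<in> sets (borel \<Otimes>\<^sub>M N)"
    by measurable
  from N.measurable_emeasure_Pair[OF this] show ?thesis
    by (simp add: space_pair_measure vimage_def)
qed

text \<open>Convolving with a probability measure preserves total mass, so both measures have the
  same mass \<open>c\<close> and can be normalised by the same factor. If \<open>c = 0\<close>, both
  vanish.\<close>

lemma finite_measure_convolution_cancel:
  fixes M1 M2 N :: "real measure"
  assumes fin: "finite_measure M1" "finite_measure M2"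
    and sets: "sets M1 = sets borel" "sets M2 = sets borel"
    and N: "real_distribution N" and char: "\<And>t. char N t \<noteq> 0"
    and eq: "(M1 \<star> N) = (M2 \<star> N)"
  shows "M1 = M2"
proof -
  interpret N: real_distribution N by fact
  have finN: "finite_measure N"
    by (rule N.finite_measure_axioms)
  have conv: "emeasure (M \<star> N) A = (\<integral>\<^sup>+x. emeasure N {z. x + z \<in> A} \<partial>M)"
    if "finite_measure M" "sets M = sets borel" "A \<in> sets borel" for M A
    using emeasure_convolution_real[OF that(1) finN that(2) _ that(3)] by simp
  define c where "c = emeasure M1 UNIV"
  have total: "emeasure (M \<star> N) UNIV = emeasure M UNIV"
    if "finite_measure M" "sets M = sets borel" for M
    using sets_eq_imp_space_eq[OF that(2)] N.emeasure_space_1 by (simp add: conv[OF that])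
  have c2: "c = emeasure M2 UNIV"
    unfolding c_def using total fin sets eq by metis
  have space: "space M1 = UNIV" "space M2 = UNIV"
    using sets[THEN sets_eq_imp_space_eq] by auto
  have cfin: "c \<noteq> \<infinity>"
    unfolding c_def using finite_measure.emeasure_finite[OF fin(1)] by simp
  show ?thesis
  proof (cases "c = 0")
    case True
    have "emeasure M1 A = 0" "emeasure M2 A = 0" for A
      using True c_def c2 by (metis emeasure_mono space sets.top le_zero_eq subset_UNIV)+
    then show ?thesis
      using sets by (intro measure_eqI) auto
  next
    case False
    have inv: "inverse c * c = 1" "c * inverse c = 1"
      using False cfin ennreal_divide_self[of c] by (auto simp: divide_ennreal_def mult.commute less_top)
    have dist: "real_distribution (scale_measure (inverse c) M)"
      if "sets M = sets borel" "c = emeasure M UNIV" for M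
    proof -
      have "prob_space (scale_measure (inverse c) M)"
        using inv that sets_eq_imp_space_eq[OF that(1)]
        by (intro prob_spaceI) (simp add: space_scale_measure)
      then show ?thesis
        using that by (simp add: real_distribution_def real_distribution_axioms_def)
    qed
    have conv_scale: "emeasure (scale_measure (inverse c) M \<star> N) A = inverse c * emeasure (M \<star> N) A"
      if "finite_measure M" "sets M = sets borel" "c = emeasure M UNIV" "A \<in> sets borel" for M A
    proof -
      interpret S: real_distribution "scale_measure (inverse c) M"
        using dist that by blast
      have finS: "finite_measure (scale_measure (inverse c) M)"
        by (rule S.finite_measure_axioms)
      have "(\<lambda>x. emeasure N {z. x + z \<in> A}) \<in> borel_measurable M"
        using borel_measurable_emeasure_translate[OF N that(4)] that(2)
        by (simp cong: measurable_cong_sets)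
      then show ?thesis
        using that conv[OF finS] by (subst conv, simp_all add: conv nn_integral_scale_measure)
    qed
    have "(scale_measure (inverse c) M1 \<star> N) = (scale_measure (inverse c) M2 \<star> N)"
      by (rule measure_eqI) (simp_all add: conv_scale[OF fin(1) sets(1) c_def]
        conv_scale[OF fin(2) sets(2) c2] eq)
    then have "scale_measure (inverse c) M1 = scale_measure (inverse c) M2"
      by (rule real_distribution_convolution_cancel
        [OF dist[OF sets(1) c_def] dist[OF sets(2) c2] N char])
    then have "scale_measure (c * inverse c) M1 = scale_measure (c * inverse c) M2"
      unfolding scale_scale_measure[symmetric] by (rule arg_cong)
    then show ?thesis
      by (simp add: inv)
  qed
qed

section \<open>Independent noise in every coordinate and its removal\<close>

definition add_noise :: "real measure \<Rightarrow> (real ^ 'n::finite) measure \<Rightarrow> (real ^ 'n) measure" where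
  "add_noise N \<nu> =
     distr (\<nu> \<Otimes>\<^sub>M PiM UNIV (\<lambda>_. N)) borel (\<lambda>(x, z). \<chi> i. x $ i + z i)"

lemma sets_add_noise [simp]: "sets (add_noise N \<nu>) = sets borel"
  by (simp add: add_noise_def)

lemma borel_measurable_vec_lambda:
  fixes f :: "'a \<Rightarrow> 'n::finite \<Rightarrow> real"
  assumes "\<And>i. (\<lambda>x. f x i) \<in> borel_measurable M"
  shows "(\<lambda>x. \<chi> i. f x i) \<in> borel_measurable M"
  by (subst borel_measurable_euclidean_space) (use assms in \<open>auto simp: Basis_vec_def inner_axis\<close>)

lemma measurable_add_noise_component:
  fixes \<nu> :: "(real ^ 'n::finite) measure"
  assumes "sets \<nu> = sets borel" "sets N = sets (borel :: real measure)"
  shows "(\<lambda>p. fst p $ i + snd p i) \<in> borel_measurable (\<nu> \<Otimes>\<^sub>M PiM UNIV (\<lambda>_ :: 'n. N))"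
proof (rule borel_measurable_add)
  have "(\<lambda>x. x $ i) \<in> borel_measurable \<nu>"
    using assms(1) borel_measurable_nth by (simp cong: measurable_cong_sets)
  then show "(\<lambda>p. fst p $ i) \<in> borel_measurable (\<nu> \<Otimes>\<^sub>M PiM UNIV (\<lambda>_ :: 'n. N))"
    by (rule measurable_compose[OF measurable_fst])
  have "(\<lambda>z. z i) \<in> PiM UNIV (\<lambda>_ :: 'n. N) \<rightarrow>\<^sub>M N"
    by (rule measurable_component_singleton) simp
  then have "(\<lambda>z. z i) \<in> borel_measurable (PiM UNIV (\<lambda>_ :: 'n. N))"
    using assms(2) by (simp cong: measurable_cong_sets)
  then show "(\<lambda>p. snd p i) \<in> borel_measurable (\<nu> \<Otimes>\<^sub>M PiM UNIV (\<lambda>_ :: 'n. N))"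
    by (rule measurable_compose[OF measurable_snd])
qed

lemma measurable_add_noise:
  fixes \<nu> :: "(real ^ 'n::finite) measure"
  assumes "sets \<nu> = sets borel" "sets N = sets (borel :: real measure)"
  shows "(\<lambda>(x, z). \<chi> i. x $ i + z i) \<in> borel_measurable (\<nu> \<Otimes>\<^sub>M PiM UNIV (\<lambda>_ :: 'n. N))"
  unfolding split_beta' by (intro borel_measurable_vec_lambda measurable_add_noise_component assms)

lemma borel_sets_box [measurable]:
  fixes A :: "'n::finite \<Rightarrow> real set"
  assumes "\<And>i. A i \<in> sets borel"
  shows "{y :: real ^ 'n. \<forall>i. y $ i \<in> A i} \<in> sets borel"
proof -
  note [measurable] = assms
  have "{y \<in> space borel. \<forall>i. y $ i \<in> A i} \<in> sets (borel :: (real ^ 'n) measure)"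
    by measurable
  then show ?thesis by simp
qed

text \<open>For a fixed starting point \<open>x\<close> the noisy coordinates are independent, so
  hitting a box factorises; then integrate over \<open>x\<close>.\<close>

lemma emeasure_add_noise_box:
  fixes \<nu> :: "(real ^ 'n::finite) measure"
  assumes \<nu>: "finite_measure \<nu>" "sets \<nu> = sets borel" and N: "real_distribution N"
    and A: "\<And>i. A i \<in> sets borel"
  shows "emeasure (add_noise N \<nu>) {y. \<forall>i. y $ i \<in> A i} =
    (\<integral>\<^sup>+x. (\<Prod>i\<in>UNIV. emeasure N {z. x $ i + z \<in> A i}) \<partial>\<nu>)"
proof -
  interpret \<nu>: finite_measure \<nu> by fact
  interpret N: real_distribution N by fact
  interpret P: product_prob_space "\<lambda>_. N" "UNIV :: 'n set" ..
  note [measurable] = A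
  let ?P = "PiM UNIV (\<lambda>_ :: 'n. N)"
  have space: "space \<nu> = UNIV" "space ?P = UNIV"
    using sets_eq_imp_space_eq[OF \<nu>(2)] by (auto simp: space_PiM)
  have [measurable]: "(\<lambda>(x, z). \<chi> i. x $ i + z i) \<in> borel_measurable (\<nu> \<Otimes>\<^sub>M ?P)"
    using \<nu>(2) by (intro measurable_add_noise) auto
  have [measurable]: "(\<lambda>p. fst p $ i + snd p i) \<in> borel_measurable (\<nu> \<Otimes>\<^sub>M ?P)" for i
    using \<nu>(2) by (intro measurable_add_noise_component) auto
  have "emeasure (add_noise N \<nu>) {y. \<forall>i. y $ i \<in> A i} =
      emeasure (\<nu> \<Otimes>\<^sub>M ?P) {p. \<forall>i. fst p $ i + snd p i \<in> A i}"
    unfolding add_noise_def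
    by (subst emeasure_distr) (auto simp: space_pair_measure space intro!: arg_cong2[where f = emeasure])
  also have "\<dots> = (\<integral>\<^sup>+x. emeasure ?P (Pair x -` {p. \<forall>i. fst p $ i + snd p i \<in> A i}) \<partial>\<nu>)"
  proof (rule P.emeasure_pair_measure_alt)
    have "{p \<in> space (\<nu> \<Otimes>\<^sub>M ?P). \<forall>i. fst p $ i + snd p i \<in> A i} \<in> sets (\<nu> \<Otimes>\<^sub>M ?P)"
      by measurable
    then show "{p. \<forall>i. fst p $ i + snd p i \<in> A i} \<in> sets (\<nu> \<Otimes>\<^sub>M ?P)"
      by (simp add: space_pair_measure space)
  qed
  also have "\<dots> = (\<integral>\<^sup>+x. (\<Prod>i\<in>UNIV. emeasure N {z. x $ i + z \<in> A i}) \<partial>\<nu>)"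
  proof (rule nn_integral_cong)
    fix x :: "real ^ 'n"
    have "Pair x -` {p. \<forall>i. fst p $ i + snd p i \<in> A i} = (\<Pi>\<^sub>E i\<in>UNIV. {z. x $ i + z \<in> A i})"
      by (auto simp: PiE_def)
    moreover have "{z. x $ i + z \<in> A i} \<in> sets N" for i
    proof -
      have "{z \<in> space N. x $ i + z \<in> A i} \<in> sets N"
        by measurable
      then show ?thesis by simp
    qed
    ultimately show "emeasure ?P (Pair x -` {p. \<forall>i. fst p $ i + snd p i \<in> A i}) =
        (\<Prod>i\<in>UNIV. emeasure N {z. x $ i + z \<in> A i})"
      by (simp add: P.emeasure_PiM)
  qed
  finally show ?thesis .
qed

text \<open>Open boxes have this form with intervals as sides, and they are an intersection-stable
  generator of the Borel sets.\<close>

lemma finite_measure_eqI_box: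
  fixes \<mu>1 \<mu>2 :: "(real ^ 'n::finite) measure"
  assumes fin: "finite_measure \<mu>1" "finite_measure \<mu>2"
    and sets: "sets \<mu>1 = sets borel" "sets \<mu>2 = sets borel"
    and eq: "\<And>A. (\<And>i. A i \<in> sets borel) \<Longrightarrow>
      emeasure \<mu>1 {y. \<forall>i. y $ i \<in> A i} = emeasure \<mu>2 {y. \<forall>i. y $ i \<in> A i}"
  shows "\<mu>1 = \<mu>2"
proof (rule measure_eqI_generator_eq)
  let ?E = "range (\<lambda>(a, b). box a b :: (real ^ 'n) set)"
  show "Int_stable ?E"
    by (auto simp: Int_stable_def box_Int_box)
  show "?E \<subseteq> Pow UNIV" "sets \<mu>1 = sigma_sets UNIV ?E" "sets \<mu>2 = sigma_sets UNIV ?E"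
    by (simp_all add: borel_eq_box sets)
  let ?A = "\<lambda>n :: nat. box (- (real n *\<^sub>R One)) (real n *\<^sub>R One) :: (real ^ 'n) set"
  show "range ?A \<subseteq> ?E" "(\<Union>i. ?A i) = UNIV"
    unfolding UN_box_eq_UNIV by auto
  show "emeasure \<mu>1 (?A i) \<noteq> \<infinity>" for i
    using finite_measure.emeasure_finite[OF fin(1)] by simp
  show "emeasure \<mu>1 X = emeasure \<mu>2 X" if X: "X \<in> ?E" for X
  proof -
    from X obtain a b where ab: "X = box a b" by auto
    have "X = {y. \<forall>i. y $ i \<in> {a $ i<..<b $ i}}"
      by (auto simp: ab mem_box_cart)
    then show ?thesis
      using eq[of "\<lambda>i. {a $ i<..<b $ i}"] by simp
  qed
qed

text \<open>The noise is removed one coordinate at a time: weighting a measure by the factors of the other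
  coordinates and projecting to the remaining one reduces each step to dimension one.\<close>

lemma add_noise_cancel:
  fixes \<nu>1 \<nu>2 :: "(real ^ 'n::finite) measure"
  assumes fin: "finite_measure \<nu>1" "finite_measure \<nu>2"
    and sets: "sets \<nu>1 = sets borel" "sets \<nu>2 = sets borel"
    and N: "real_distribution N" and char: "\<And>t. char N t \<noteq> 0"
    and eq: "add_noise N \<nu>1 = add_noise N \<nu>2"
  shows "\<nu>1 = \<nu>2"
proof -
  interpret N: real_distribution N by fact
  \<comment> \<open>\<open>T\<close> collects the coordinates already freed of noise. The empty set
    gives box masses of \<open>add_noise N \<nu>\<close>, and \<open>UNIV\<close> gives those of
    \<open>\<nu>\<close> itself.\<close>
  define g :: "'n set \<Rightarrow> ('n \<Rightarrow> real set) \<Rightarrow> 'n \<Rightarrow> real \<Rightarrow> ennreal" where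
    "g T A i r = (if i \<in> T then indicator (A i) r else emeasure N {z. r + z \<in> A i})" for T A i r
  have g_meas: "g T A i \<in> borel_measurable borel" if "A i \<in> sets borel" for T A i
    using borel_measurable_emeasure_translate[OF N that] that unfolding g_def by (cases "i \<in> T") auto
  have g_le: "g T A i r \<le> 1" for T A i r
    by (auto simp: g_def indicator_def N.emeasure_le_1)
  have "(\<integral>\<^sup>+x. (\<Prod>i\<in>UNIV. g T A i (x $ i)) \<partial>\<nu>1) = (\<integral>\<^sup>+x. (\<Prod>i\<in>UNIV. g T A i (x $ i)) \<partial>\<nu>2)"
    if "\<And>i. A i \<in> sets borel" for T A
    using finite[of T] that
  \<comment> \<open>The sides must stay arbitrary: the induction hypothesis is used with side
    \<open>j\<close> replaced by every Borel set \<open>B\<close>.\<close>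
  proof (induction T arbitrary: A rule: finite_induct)
    case empty
    then show ?case
      using emeasure_add_noise_box[OF fin(1) sets(1) N, of A]
        emeasure_add_noise_box[OF fin(2) sets(2) N, of A] eq
      by (simp add: g_def)
  next
    case (insert j T)
    define v :: "real ^ 'n \<Rightarrow> ennreal" where "v x = (\<Prod>i\<in>UNIV - {j}. g T A i (x $ i))" for x
    define \<rho> where "\<rho> \<nu> = distr (density \<nu> v) borel (\<lambda>x. x $ j)" for \<nu> :: "(real ^ 'n) measure"
    have v_meas: "v \<in> borel_measurable borel"
      unfolding v_def
      by (intro borel_measurable_prod_ennreal measurable_compose[OF borel_measurable_nth g_meas]
        insert.prems)
    have v_le: "v x \<le> 1" for x
      unfolding v_def by (rule prod_le_1) (auto simp: g_le)
    have nn: "(\<integral>\<^sup>+r. f r \<partial>\<rho> \<nu>) = (\<integral>\<^sup>+x. v x * f (x $ j) \<partial>\<nu>)"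
      if "sets \<nu> = sets borel" "f \<in> borel_measurable borel" for \<nu> f
    proof -
      note [measurable_cong] = that(1)
      note [measurable] = that(2) v_meas
      show ?thesis
        unfolding \<rho>_def by (simp add: nn_integral_distr nn_integral_density)
    qed
    \<comment> \<open>The weight \<open>v\<close> may remove mass, even all of it; this is why
      cancellation was proved for finite measures.\<close>
    have fin_\<rho>: "finite_measure (\<rho> \<nu>)" if "finite_measure \<nu>" "sets \<nu> = sets borel" for \<nu>
    proof (rule finite_measureI)
      have "emeasure (\<rho> \<nu>) (space (\<rho> \<nu>)) = (\<integral>\<^sup>+r. 1 \<partial>\<rho> \<nu>)"
        by simp
      also have "\<dots> = (\<integral>\<^sup>+x. v x * 1 \<partial>\<nu>)"
        by (rule nn[OF that(2)]) simp
      also have "\<dots> \<le> (\<integral>\<^sup>+x. 1 \<partial>\<nu>)"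
        by (intro nn_integral_mono) (simp add: v_le)
      also have "\<dots> < \<infinity>"
        using finite_measure.emeasure_finite[OF that(1)] by (simp add: less_top)
      finally show "emeasure (\<rho> \<nu>) (space (\<rho> \<nu>)) \<noteq> \<infinity>" by simp
    qed
    have sets_\<rho>: "sets (\<rho> \<nu>) = sets borel" for \<nu>
      by (simp add: \<rho>_def)
    \<comment> \<open>As \<open>j\<close> lies outside \<open>T\<close>, its factor is still noisy,
      and smoothing the weighted projection produces exactly that factor.\<close>
    have conv: "emeasure (\<rho> \<nu> \<star> N) B = (\<integral>\<^sup>+x. (\<Prod>i\<in>UNIV. g T (A(j := B)) i (x $ i)) \<partial>\<nu>)"
      if "finite_measure \<nu>" "sets \<nu> = sets borel" "B \<in> sets borel" for \<nu> B
    proof -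
      have "emeasure (\<rho> \<nu> \<star> N) B = (\<integral>\<^sup>+x. v x * emeasure N {z. x $ j + z \<in> B} \<partial>\<nu>)"
        using that fin_\<rho> sets_\<rho> N.finite_measure_axioms borel_measurable_emeasure_translate[OF N]
        by (subst emeasure_convolution_real) (auto simp: nn)
      also have "\<dots> = (\<integral>\<^sup>+x. (\<Prod>i\<in>UNIV. g T (A(j := B)) i (x $ i)) \<partial>\<nu>)"
      proof (rule nn_integral_cong)
        fix x
        have "(\<Prod>i\<in>UNIV - {j}. g T (A(j := B)) i (x $ i)) = v x"
          unfolding v_def by (rule prod.cong) (auto simp: g_def)
        moreover have "g T (A(j := B)) j (x $ j) = emeasure N {z. x $ j + z \<in> B}"
          using insert.hyps by (simp add: g_def)
        ultimately show "v x * emeasure N {z. x $ j + z \<in> B} = (\<Prod>i\<in>UNIV. g T (A(j := B)) i (x $ i))"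
          by (simp only: prod.remove[OF finite UNIV_I, of _ j] mult.commute)
      qed
      finally show ?thesis .
    qed
    have "(\<rho> \<nu>1 \<star> N) = (\<rho> \<nu>2 \<star> N)"
    proof (rule measure_eqI)
      fix B assume "B \<in> sets (\<rho> \<nu>1 \<star> N)"
      then have B: "B \<in> sets borel" by simp
      show "emeasure (\<rho> \<nu>1 \<star> N) B = emeasure (\<rho> \<nu>2 \<star> N) B"
        unfolding conv[OF fin(1) sets(1) B] conv[OF fin(2) sets(2) B]
        by (rule insert.IH) (use B insert.prems in auto)
    qed simp
    then have \<rho>_eq: "\<rho> \<nu>1 = \<rho> \<nu>2"
      by (rule finite_measure_convolution_cancel[OF fin_\<rho>[OF fin(1) sets(1)]
        fin_\<rho>[OF fin(2) sets(2)] sets_\<rho> sets_\<rho> N char])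
    have "(\<integral>\<^sup>+x. (\<Prod>i\<in>UNIV. g (insert j T) A i (x $ i)) \<partial>\<nu>) = (\<integral>\<^sup>+r. indicator (A j) r \<partial>\<rho> \<nu>)"
      if "sets \<nu> = sets borel" for \<nu>
    proof -
      have "(\<Prod>i\<in>UNIV. g (insert j T) A i (x $ i)) = v x * indicator (A j) (x $ j)" for x
      proof -
        have "(\<Prod>i\<in>UNIV - {j}. g (insert j T) A i (x $ i)) = v x"
          unfolding v_def by (rule prod.cong) (auto simp: g_def)
        moreover have "g (insert j T) A j (x $ j) = indicator (A j) (x $ j)"
          by (simp add: g_def)
        ultimately show ?thesis
          by (simp only: prod.remove[OF finite UNIV_I, of _ j] mult.commute)
      qed
      then show ?thesis
        using nn[OF that borel_measurable_indicator[OF insert.prems]] by simp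
    qed
    then show ?case
      using sets \<rho>_eq by simp
  qed
  from this[of _ UNIV]
  have box: "(\<integral>\<^sup>+x. (\<Prod>i\<in>UNIV. indicator (A i) (x $ i)) \<partial>\<nu>1) =
      (\<integral>\<^sup>+x. (\<Prod>i\<in>UNIV. indicator (A i) (x $ i)) \<partial>\<nu>2)" if "\<And>i. A i \<in> sets borel" for A
    using that by (simp add: g_def)
  have ind: "(\<Prod>i\<in>UNIV. indicator (A i) (x $ i)) = (indicator {y. \<forall>i. y $ i \<in> A i} x :: ennreal)"
    for A :: "'n \<Rightarrow> real set" and x
    by (auto simp: indicator_def prod_zero_iff)
  show ?thesis
  proof (rule finite_measure_eqI_box[OF fin sets])
    fix A :: "'n \<Rightarrow> real set"
    assume A: "\<And>i. A i \<in> sets borel"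
    show "emeasure \<nu>1 {y. \<forall>i. y $ i \<in> A i} = emeasure \<nu>2 {y. \<forall>i. y $ i \<in> A i}"
      using box[of A] A borel_sets_box[OF A] sets by (simp add: ind)
  qed
qed

section \<open>Moments of the smoothed measure\<close>

text \<open>A dominating function chosen to be polynomial, hence integrable against
  \<open>\<nu>\<close>, and to factorise over coordinates, hence integrable against product
  noise.\<close>

definition growth_weight :: "real ^ 'n::finite \<Rightarrow> real" where
  "growth_weight x = (\<Prod>i\<in>UNIV. 1 + (x $ i)\<^sup>2)"

lemma growth_weight_ge_1: "1 \<le> growth_weight x"
  unfolding growth_weight_def by (rule prod_ge_1) simp

lemma abs_component_le_growth_weight: "\<bar>x $ i\<bar> \<le> growth_weight x"
proof -
  have "\<bar>x $ i\<bar> \<le> 1 + (x $ i)\<^sup>2"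
  proof -
    have "0 \<le> (\<bar>x $ i\<bar> - 1)\<^sup>2" by simp
    then have "2 * \<bar>x $ i\<bar> \<le> 1 + (x $ i)\<^sup>2"
      by (simp add: power2_diff)
    then show ?thesis
      using zero_le_power2[of "x $ i"] by linarith
  qed
  also have "\<dots> \<le> growth_weight x"
  proof -
    have "1 \<le> (\<Prod>j\<in>UNIV - {i}. 1 + (x $ j)\<^sup>2)"
      by (rule prod_ge_1) simp
    then have "(1 + (x $ i)\<^sup>2) * 1 \<le> (1 + (x $ i)\<^sup>2) * (\<Prod>j\<in>UNIV - {i}. 1 + (x $ j)\<^sup>2)"
      by (intro mult_left_mono) auto
    then show ?thesis
      unfolding growth_weight_def by (subst prod.remove[of _ i]) auto
  qed
  finally show ?thesis .
qed

text \<open>In each coordinate the difference of the two sides is 1 + (a - b)^2 + 2 (a b)^2; every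
  coordinate contributes one factor 2.\<close>

lemma growth_weight_add_le:
  fixes x y :: "real ^ 'n::finite"
  shows "growth_weight (x + y) \<le> 2 ^ CARD('n) * (growth_weight x * growth_weight y)"
proof -
  have "1 + (a + b)\<^sup>2 \<le> 2 * ((1 + a\<^sup>2) * (1 + b\<^sup>2))" for a b :: real
  proof -
    have "2 * ((1 + a\<^sup>2) * (1 + b\<^sup>2)) - (1 + (a + b)\<^sup>2) = 1 + (a - b)\<^sup>2 + 2 * (a * b)\<^sup>2"
      by (simp add: power2_eq_square algebra_simps)
    moreover have "0 \<le> 1 + (a - b)\<^sup>2 + 2 * (a * b)\<^sup>2"
      by simp
    ultimately show ?thesis by linarith
  qed
  then have "growth_weight (x + y) \<le> (\<Prod>i\<in>UNIV. 2 * ((1 + (x $ i)\<^sup>2) * (1 + (y $ i)\<^sup>2)))"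
    unfolding growth_weight_def by (intro prod_mono) auto
  also have "\<dots> = 2 ^ CARD('n) * (growth_weight x * growth_weight y)"
    by (simp add: growth_weight_def prod.distrib)
  finally show ?thesis .
qed

text \<open>Since the weight is at least 1, exponents may be raised, so \<open>m + n\<close> serves
  for sums as well as for products.\<close>

lemma real_polynomial_function_growth:
  fixes p :: "real ^ 'n::finite \<Rightarrow> real"
  assumes "real_polynomial_function p"
  shows "\<exists>C m. 0 \<le> C \<and> (\<forall>x. \<bar>p x\<bar> \<le> C * growth_weight x ^ m)"
  using assms
proof induction
  case (linear f)
  then interpret bounded_linear f .
  obtain K where K: "0 \<le> K" "\<And>x. norm (f x) \<le> norm x * K"
    using nonneg_bounded by blast
  have "\<bar>f x\<bar> \<le> (K * CARD('n)) * growth_weight x ^ 1" for x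
  proof -
    have "\<bar>f x\<bar> \<le> norm x * K"
      using K(2)[of x] by simp
    also have "norm x \<le> (\<Sum>i\<in>UNIV. \<bar>x $ i\<bar>)"
      by (rule norm_le_l1_cart)
    also have "\<dots> \<le> (\<Sum>i\<in>(UNIV :: 'n set). growth_weight x)"
      by (intro sum_mono abs_component_le_growth_weight)
    finally show ?thesis
      using K(1) by (simp add: mult_right_mono mult_ac)
  qed
  then show ?case
    using K(1) by (intro exI[of _ "K * CARD('n)"] exI[of _ 1]) auto
next
  case (const c)
  show ?case
    by (intro exI[of _ "\<bar>c\<bar>"] exI[of _ 0]) auto
next
  case (add f g)
  then obtain C m D n where C: "0 \<le> C" "\<And>x. \<bar>f x\<bar> \<le> C * growth_weight x ^ m"
    and D: "0 \<le> D" "\<And>x. \<bar>g x\<bar> \<le> D * growth_weight x ^ n"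
    by blast
  have "\<bar>f x + g x\<bar> \<le> (C + D) * growth_weight x ^ (m + n)" for x
  proof -
    have "C * growth_weight x ^ m \<le> C * growth_weight x ^ (m + n)"
      "D * growth_weight x ^ n \<le> D * growth_weight x ^ (m + n)"
      using C D by (auto intro!: mult_left_mono power_increasing growth_weight_ge_1)
    then show ?thesis
      using C(2)[of x] D(2)[of x] by (simp add: ring_distribs)
  qed
  then show ?case
    using C D by (intro exI[of _ "C + D"] exI[of _ "m + n"]) auto
next
  case (mult f g)
  then obtain C m D n where C: "0 \<le> C" "\<And>x. \<bar>f x\<bar> \<le> C * growth_weight x ^ m"
    and D: "0 \<le> D" "\<And>x. \<bar>g x\<bar> \<le> D * growth_weight x ^ n"
    by blast
  have "\<bar>f x * g x\<bar> \<le> (C * D) * growth_weight x ^ (m + n)" for x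
    using mult_mono[OF C(2)[of x] D(2)[of x]] order.trans[OF zero_le_one growth_weight_ge_1[of x]] C D
    by (simp add: abs_mult power_add mult_ac)
  then show ?case
    using C D by (intro exI[of _ "C * D"] exI[of _ "m + n"]) auto
qed

lemma real_polynomial_function_growth_weight:
  "real_polynomial_function (growth_weight :: real ^ 'n::finite \<Rightarrow> real)"
  unfolding growth_weight_def
  by (intro real_polynomial_function_prod real_polynomial_function.intros(2,3)
    real_polynomial_function_power real_polynomial_function_component) simp_all

lemma borel_measurable_real_polynomial_function:
  fixes p :: "real ^ 'n::finite \<Rightarrow> real"
  shows "real_polynomial_function p \<Longrightarrow> p \<in> borel_measurable borel"
  by (intro borel_measurable_continuous_onI continuous_on_polymonial_function)
    (simp add: real_polynomial_function_eq)

lemma real_polynomial_function_mpow: "real_polynomial_function (\<lambda>x. mpow x \<alpha>)"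
  unfolding mpow_def
  by (intro real_polynomial_function_prod real_polynomial_function_power
    real_polynomial_function_component) simp

lemma representing_measure_finite:
  assumes "representing_measure m \<nu>"
  shows "finite_measure \<nu>"
proof -
  have "integrable \<nu> (\<lambda>_. 1 :: real)"
    using assms real_polynomial_function.intros(2)[of 1] unfolding representing_measure_def by blast
  then show ?thesis
    by (intro finite_measureI) (simp add: integrable_iff_bounded less_top)
qed

lemma integrable_growth_weight_PiM:
  assumes N: "real_distribution N" and int: "\<And>k. integrable N (\<lambda>z. z ^ k)"
  shows "integrable (PiM UNIV (\<lambda>_. N)) (\<lambda>z. growth_weight (vec_lambda z :: real ^ 'n::finite) ^ m)"
proof -
  interpret N: real_distribution N by fact
  interpret P: product_prob_space "\<lambda>_. N" "UNIV :: 'n set" ..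
  have "(1 + z\<^sup>2) ^ m = (\<Sum>k\<le>m. of_nat (m choose k) * z ^ (2 * (m - k)))" for z :: real
    by (simp add: binomial_ring power_mult)
  then have "integrable N (\<lambda>z. (1 + z\<^sup>2) ^ m)"
    using int by (auto intro!: Bochner_Integration.integrable_sum)
  then show ?thesis
    unfolding growth_weight_def prod_power_distrib
    by (simp, intro P.product_integrable_prod) auto
qed

text \<open>By submultiplicativity of the weight, a polynomial in x + z is dominated by a function
  of x times a function of z, each integrable by itself.\<close>

lemma integrable_add_noise:
  fixes \<nu> :: "(real ^ 'n::finite) measure"
  assumes \<nu>: "representing_measure m \<nu>" and N: "real_distribution N"
    and int: "\<And>k. integrable N (\<lambda>z. z ^ k)" and p: "real_polynomial_function p"
  shows "integrable (add_noise N \<nu>) p"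
    and "integrable (\<nu> \<Otimes>\<^sub>M PiM UNIV (\<lambda>_. N)) (\<lambda>(x, z). p (\<chi> i. x $ i + z i))"
proof -
  interpret \<nu>: finite_measure \<nu> by (rule representing_measure_finite[OF \<nu>])
  interpret N: real_distribution N by fact
  interpret P: product_prob_space "\<lambda>_. N" "UNIV :: 'n set" ..
  let ?P = "PiM UNIV (\<lambda>_ :: 'n. N)"
  interpret pair_sigma_finite \<nu> ?P ..
  have sets: "sets \<nu> = sets borel"
    using \<nu> by (simp add: representing_measure_def)
  note [measurable_cong] = sets
  note [measurable] = measurable_add_noise[OF sets N.events_eq_borel]
    borel_measurable_real_polynomial_function[OF p]
    borel_measurable_real_polynomial_function[OF real_polynomial_function_growth_weight]
  have [measurable]: "vec_lambda \<in> borel_measurable ?P"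
    using borel_measurable_vec_lambda[of "\<lambda>z i. z i" ?P] by simp
  obtain C k where C: "0 \<le> C" "\<And>x. \<bar>p x\<bar> \<le> C * growth_weight x ^ k"
    using real_polynomial_function_growth[OF p] by blast
  define G :: "real ^ 'n \<Rightarrow> real" where "G x = growth_weight x ^ k" for x
  have G0: "0 \<le> G x" for x
    using growth_weight_ge_1[of x] by (simp add: G_def)
  have G_meas [measurable]: "G \<in> borel_measurable borel"
    unfolding G_def by measurable
  have G_\<nu>: "integrable \<nu> G"
    using \<nu> real_polynomial_function_power[OF real_polynomial_function_growth_weight]
    unfolding G_def representing_measure_def by blast
  have G_P: "integrable ?P (\<lambda>z. G (vec_lambda z))"
    unfolding G_def by (rule integrable_growth_weight_PiM[OF N int])
  let ?c = "C * (2 ^ CARD('n)) ^ k"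
  have "integrable (\<nu> \<Otimes>\<^sub>M ?P) (\<lambda>(x, z). ?c * (G x * G (vec_lambda z)))"
  proof (rule Fubini_integrable)
    show "integrable \<nu> (\<lambda>x. LINT z|?P. norm (case (x, z) of (x, z) \<Rightarrow> ?c * (G x * G (vec_lambda z))))"
      using G0 C(1) G_\<nu> by (simp add: abs_mult)
    show "AE x in \<nu>. integrable ?P (\<lambda>z. case (x, z) of (x, z) \<Rightarrow> ?c * (G x * G (vec_lambda z)))"
      using G_P by simp
  qed measurable
  then show *: "integrable (\<nu> \<Otimes>\<^sub>M ?P) (\<lambda>(x, z). p (\<chi> i. x $ i + z i))"
  proof (rule Bochner_Integration.integrable_bound)
    have "\<bar>p (\<chi> i. x $ i + z i)\<bar> \<le> ?c * (G x * G (vec_lambda z))" for x :: "real ^ 'n" and z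
    proof -
      have "\<bar>p (\<chi> i. x $ i + z i)\<bar> \<le> C * growth_weight (x + vec_lambda z) ^ k"
        using C(2)[of "x + vec_lambda z"] by (simp add: plus_vec_def)
      also have "\<dots> \<le> C * (2 ^ CARD('n) * (growth_weight x * growth_weight (vec_lambda z :: real ^ 'n))) ^ k"
        using order.trans[OF zero_le_one growth_weight_ge_1[of "x + vec_lambda z"]] C(1)
        by (intro mult_left_mono power_mono growth_weight_add_le) auto
      also have "\<dots> = ?c * (G x * G (vec_lambda z))"
        by (simp add: G_def power_mult_distrib)
      finally show ?thesis .
    qed
    then show "AE q in \<nu> \<Otimes>\<^sub>M ?P. norm (case q of (x, z) \<Rightarrow> p (\<chi> i. x $ i + z i))
        \<le> norm (case q of (x, z) \<Rightarrow> ?c * (G x * G (vec_lambda z)))"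
      by (intro AE_I2) (auto split: prod.split intro: order.trans[OF _ abs_ge_self])
  qed (unfold split_beta', use measurable_compose[OF measurable_add_noise[OF sets N.events_eq_borel]
      borel_measurable_real_polynomial_function[OF p]] in \<open>simp add: split_beta'\<close>)
  show "integrable (add_noise N \<nu>) p"
    unfolding add_noise_def using * by (subst integrable_distr_eq) (auto simp: split_beta')
qed

text \<open>By Fubini and independence, each moment reduces to shifted one-dimensional moments of
  \<open>N\<close>; \<open>moment\<close> is all that the caloric polynomials need from the
  noise.\<close>

lemma representing_measure_add_noise:
  fixes \<nu> :: "(real ^ 'n::finite) measure"
  assumes \<nu>: "representing_measure m \<nu>" and N: "real_distribution N"
    and int: "\<And>k. integrable N (\<lambda>z. z ^ k)"
    and moment: "\<And>k x. (LINT z|N. (x + z) ^ k) = poly (heat_monom k x) c"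
  shows "representing_measure (\<lambda>\<alpha>. LINT x|\<nu>. poly (heat_mpow \<alpha> x) c) (add_noise N \<nu>)"
  unfolding representing_measure_def
proof (intro conjI allI impI)
  interpret \<nu>: finite_measure \<nu> by (rule representing_measure_finite[OF \<nu>])
  interpret N: real_distribution N by fact
  interpret P: product_prob_space "\<lambda>_. N" "UNIV :: 'n set" ..
  let ?P = "PiM UNIV (\<lambda>_ :: 'n. N)"
  interpret pair_sigma_finite \<nu> ?P ..
  have sets: "sets \<nu> = sets borel"
    using \<nu> by (simp add: representing_measure_def)
  note [measurable] = measurable_add_noise[OF sets N.events_eq_borel]
  show "integrable (add_noise N \<nu>) p" if "real_polynomial_function p" for p
    using integrable_add_noise(1)[OF \<nu> N int that] .
  fix \<alpha> :: "'n \<Rightarrow> nat"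
  have int_shift: "integrable N (\<lambda>z. (x + z) ^ k)" for x k
    unfolding binomial_ring using int by (auto intro!: Bochner_Integration.integrable_sum)
  have "(LINT x|add_noise N \<nu>. mpow x \<alpha>) =
      (LINT q|(\<nu> \<Otimes>\<^sub>M ?P). (case q of (x, z) \<Rightarrow> mpow (\<chi> i. x $ i + z i) \<alpha>))"
    unfolding add_noise_def
    using borel_measurable_real_polynomial_function[OF real_polynomial_function_mpow]
    by (subst integral_distr) (auto simp: split_beta')
  also have "\<dots> = (LINT x|\<nu>. LINT z|?P. mpow (\<chi> i. x $ i + z i) \<alpha>)"
    using integral_fst'[OF integrable_add_noise(2)[OF \<nu> N int real_polynomial_function_mpow]] by simp
  also have "\<dots> = (LINT x|\<nu>. poly (heat_mpow \<alpha> x) c)"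
  proof (rule Bochner_Integration.integral_cong[OF refl])
    fix x :: "real ^ 'n"
    have "(LINT z|?P. mpow (\<chi> i. x $ i + z i) \<alpha>) = (LINT z|?P. (\<Prod>i\<in>UNIV. (x $ i + z i) ^ \<alpha> i))"
      by (simp add: mpow_def)
    also have "\<dots> = (\<Prod>i\<in>UNIV. LINT z|N. (x $ i + z) ^ \<alpha> i)"
      by (rule P.product_integral_prod) (auto intro: int_shift)
    also have "\<dots> = poly (heat_mpow \<alpha> x) c"
      by (simp add: moment heat_mpow_def poly_prod)
    finally show "(LINT z|?P. mpow (\<chi> i. x $ i + z i) \<alpha>) = poly (heat_mpow \<alpha> x) c" .
  qed
  finally show "(LINT x|\<nu>. poly (heat_mpow \<alpha> x) c) = (LINT x|add_noise N \<nu>. mpow x \<alpha>)" ..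
qed simp

section \<open>Gaussian noise\<close>

text \<open>An image measure instead of a density, so that \<sigma> = 0 is allowed and gives the
  point mass at 0; this covers time 0 without a case distinction.\<close>

definition scaled_normal :: "real \<Rightarrow> real measure" where
  "scaled_normal \<sigma> = distr std_normal_distribution borel (\<lambda>z. \<sigma> * z)"

lemma real_distribution_scaled_normal: "real_distribution (scaled_normal \<sigma>)"
proof -
  interpret real_distribution std_normal_distribution by (rule real_dist_normal_dist)
  show ?thesis
    unfolding scaled_normal_def by (rule real_distribution_distr) simp
qed

lemma char_scaled_normal: "char (scaled_normal \<sigma>) t \<noteq> 0"
proof -
  have "char (scaled_normal \<sigma>) t = char std_normal_distribution (t * \<sigma>)"
    unfolding char_def scaled_normal_def by (subst integral_distr) (simp_all add: mult_ac)
  then show ?thesis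
    by (simp add: char_std_normal_distribution)
qed

lemma integrable_scaled_normal_moment: "integrable (scaled_normal \<sigma>) (\<lambda>z. z ^ k)"
  unfolding scaled_normal_def
  by (subst integrable_distr_eq)
    (auto simp: power_mult_distrib intro!: integrable_mult_right integrable_std_normal_distribution_moment)

text \<open>In the binomial expansion the odd moments vanish. The even ones are (2i)! / (2^i i!),
  whose (2i)! cancels against the binomial coefficient and whose 2^i cancels against \<sigma>^(2i) =
  2^i c^i.\<close>

lemma scaled_normal_shifted_moment:
  assumes "\<sigma>\<^sup>2 = 2 * c"
  shows "(LINT z|scaled_normal \<sigma>. (x + z) ^ k) = poly (heat_monom k x) c"
proof -
  define M where "M j = (LINT z|std_normal_distribution. z ^ j)" for j :: nat
  define f where "f j = of_nat (k choose j) * \<sigma> ^ j * M j * x ^ (k - j)" for j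
  have "(LINT z|scaled_normal \<sigma>. (x + z) ^ k) = (LINT z|std_normal_distribution. (\<sigma> * z + x) ^ k)"
    unfolding scaled_normal_def by (subst integral_distr) (simp_all add: add.commute)
  also have "\<dots> = (LINT z|std_normal_distribution.
      (\<Sum>j\<le>k. (of_nat (k choose j) * \<sigma> ^ j * x ^ (k - j)) * z ^ j))"
    by (simp add: binomial_ring power_mult_distrib mult_ac)
  also have "\<dots> = (\<Sum>j\<le>k. f j)"
    by (subst Bochner_Integration.integral_sum)
      (auto intro!: integrable_mult_right integrable_std_normal_distribution_moment sum.cong
        simp: f_def M_def)
  also have "\<dots> = (\<Sum>j\<in>(\<lambda>i. 2 * i) ` {..k div 2}. f j)"
  proof (rule sum.mono_neutral_right)
    show "\<forall>j\<in>{..k} - (\<lambda>i. 2 * i) ` {..k div 2}. f j = 0"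
    proof
      fix j assume j: "j \<in> {..k} - (\<lambda>i. 2 * i) ` {..k div 2}"
      then have "odd j"
        by (auto elim!: evenE)
      then show "f j = 0"
        unfolding f_def M_def using integral_std_normal_distribution_moment_odd[of j] by simp
    qed
  qed auto
  also have "\<dots> = (\<Sum>i\<le>k div 2. f (2 * i))"
    by (subst sum.reindex) (auto simp: inj_on_def)
  also have "\<dots> = poly (heat_monom k x) c"
    unfolding heat_monom_def poly_sum poly_monom
  proof (rule sum.cong[OF refl])
    fix i assume "i \<in> {..k div 2}"
    then have i: "2 * i \<le> k" by auto
    have "of_nat (k choose (2 * i)) = (fact k / (fact (2 * i) * fact (k - 2 * i)) :: real)"
      by (rule binomial_fact[OF i])
    moreover have "M (2 * i) = fact (2 * i) / (2 ^ i * fact i)"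
      unfolding M_def by (rule std_normal_distribution_even_moments)
    moreover have "\<sigma> ^ (2 * i) = 2 ^ i * c ^ i"
      by (simp add: power_mult assms power_mult_distrib)
    ultimately show "f (2 * i) = fact k / (fact (k - 2 * i) * fact i) * x ^ (k - 2 * i) * c ^ i"
      by (simp add: f_def)
  qed
  finally show ?thesis .
qed

theorem corollary2p25:
  fixes s :: "('n::finite \<Rightarrow> nat) \<Rightarrow> real"
  assumes "s \<in> moment_sequences"
    and "determinate s"
  shows "\<forall>t \<in> moment_times s \<inter> {..0}. determinate (heat_moments s t)"
proof
  fix t assume "t \<in> moment_times s \<inter> {..0}"
  then have t: "heat_moments s t \<in> moment_sequences" "t \<le> 0"
    by (auto simp: moment_times_def)
  \<comment> \<open>The variance is 2c for the elapsed time c = - t; t \<le> 0 ensures that the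
    square root squares back to it.\<close>
  define N where "N = scaled_normal (sqrt (2 * - t))"
  have N: "real_distribution N"
    unfolding N_def by (rule real_distribution_scaled_normal)
  have forward: "representing_measure s (add_noise N \<nu>)"
    if "representing_measure (heat_moments s t) \<nu>" for \<nu>
  proof -
    have "representing_measure (\<lambda>\<alpha>. LINT x|\<nu>. poly (heat_mpow \<alpha> x) (- t)) (add_noise N \<nu>)"
      using t(2) unfolding N_def
      by (intro representing_measure_add_noise[OF that] real_distribution_scaled_normal
        integrable_scaled_normal_moment scaled_normal_shifted_moment) simp
    also have "(\<lambda>\<alpha>. LINT x|\<nu>. poly (heat_mpow \<alpha> x) (- t)) = s"
      using backward_heat_moments[OF that] by auto
    finally show ?thesis .
  qed
  have "\<nu>1 = \<nu>2" if \<nu>: "representing_measure (heat_moments s t) \<nu>1"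
    "representing_measure (heat_moments s t) \<nu>2" for \<nu>1 \<nu>2
  proof (rule add_noise_cancel[OF \<nu>[THEN representing_measure_finite] _ _ N])
    show "sets \<nu>1 = sets borel" "sets \<nu>2 = sets borel"
      using \<nu> by (auto simp: representing_measure_def)
    show "char N u \<noteq> 0" for u
      unfolding N_def by (rule char_scaled_normal)
    show "add_noise N \<nu>1 = add_noise N \<nu>2"
      using \<open>determinate s\<close> \<nu>[THEN forward] by (auto simp: determinate_def)
  qed
  then show "determinate (heat_moments s t)"
    using t(1) unfolding determinate_def moment_sequences_def by blast
qed

end
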